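(* Let $\phi:\mathbb{R}^n\to\mathbb{R}$ be convex and continuously differentiable with $L$-Lipschitz gradient, and let $|f(x,\xi)-\phi(x)|\le\epsilon_f$ for all $x\in\mathbb{R}^n$ and all realizations of $\xi$. Run the modified line search algorithm of the context with $d_k=-g_k$. Suppose there is a constant $D>0$ with $\|x-x^\star\|\le D$ for all $x\in\mathcal{U}$, where $x^\star$ is some global minimizer of $\phi$, $\phi^\star=\phi(x^\star)$, and the set $\mathcal{U}$ contains all realizations of the iterates. Suppose the random gradients $\{G_k\}$ are $(1-\delta)$-probabilistically sufficiently accurate with constant $\theta\in[0,\frac{1-c_1}{2-c_1})$ (see context), with $\delta<\frac12-\frac{\sqrt\gamma}{2}$ for some $\gamma\in(0,1)$. Suppose, with this same $\gamma$, that $\epsilon>0$ satisfies $$\epsilon^2>\max\left\{\frac{8\epsilon_fLD^2}{\gamma c_1(1-\theta)(1-2\theta-c_1(1-\theta))},\,16\epsilon_f^2\right\}.$$ Then the expected number of iterations $N_\epsilon$ that the algorithm takes until $\phi(X_k)-\phi^\star\le\epsilon$ occurs (for the first time) satisfies $$\mathbb{E}[N_\epsilon]\le\frac{2(1-\delta)}{(1-2\delta)^2-\gamma}\left[M\left(\frac1\epsilon-\frac{1}{\phi(x_0)-\phi^\star}\right)+(1-\gamma)\log_\tau\left(\frac{\bar\alpha}{\alpha_0}\right)\right],$$ where $M=\frac{4LD^2}{c_1(1-\theta)(1-2\theta-c_1(1-\theta))}$ and $\bar\alpha=\frac{2(1-2\theta-c_1(1-\theta))}{L(1-\theta)}$.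
   Context: **Algorithm.** Inputs: $x_0\in\mathbb{R}^n$, $\alpha_0>0$, $\tau\in(0,1]$, $c_1\in(0,1)$, noise bound $\epsilon_f\ge0$. At iteration $k=0,1,2,\dots$: construct a (random) gradient estimate $g_k$ of $\nabla\phi(x_k)$ and set $d_k=-g_k$; check $$f(x_k+\alpha_kd_k,\xi)\le f(x_k,\xi)+c_1\alpha_kd_k^Tg_k+2\epsilon_f$$ (the realizations of $\xi$ in the two evaluations may be different, dependent, independent or identical). If it holds, iteration $k$ is successful: $x_{k+1}=x_k+\alpha_kd_k$, $\alpha_{k+1}=\tau^{-1}\alpha_k$. Otherwise it is unsuccessful: $x_{k+1}=x_k$, $\alpha_{k+1}=\tau\alpha_k$. Random versions of $g_k,x_k,\alpha_k$ are denoted $G_k,X_k,\mathcal{A}_k$. $\mathcal{E}_{k-1}$ is all function-noise history up to iteration $k-1$, and $\mathcal{F}_{k-1}^{G,\mathcal{E}}=\sigma(G_0,\dots,G_{k-1},\mathcal{E}_{k-1})$; $X_k$ and $\mathcal{A}_k$ are determined by $\mathcal{F}_{k-1}^{G,\mathcal{E}}$. **Sufficiently accurate gradients.** $\{G_k\}$ is $(1-\delta)$-probabilistically sufficiently accurate with constant $\theta\in[0,\frac{1-c_1}{2-c_1})$ if the indicators $I_k=\mathbf{1}\{\|G_k-\nabla\phi(X_k)\|\le\theta\|\nabla\phi(X_k)\|\}$ satisfy $\mathbb{P}(I_k=1\mid\mathcal{F}_{k-1}^{G,\mathcal{E}})\ge1-\delta$ for all $k$ and all realizations of $\mathcal{F}_{k-1}^{G,\mathcal{E}}$.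 Norms are Euclidean. **Step size convention.** It is assumed, without loss of generality, that $\bar\alpha=\tau^c\alpha_0$ for some positive integer $c$. If $\tau=1$ the step size is constant and must start at a value $\alpha_0\le\bar\alpha$; for $\tau=1$ and $\alpha_0=\bar\alpha$ the term with $\log_\tau$ is read as zero.
   Formalization: Added: ε ≤ φ(x₀) − φ* (otherwise the bound can be negative while N_ε = 0), and, only for τ = 1, M(1/ε − 1/(φ(x₀) − φ* )) ≥ 1 (otherwise the bound can be below 1 while N_ε ≥ 1). *)

theory Defs
  imports "HOL-Probability.Probability"
begin

text \<open>
  The two noise realizations used at one iteration (at the current point and at the trial
  point) are the separate arguments \<open>s\<close> and \<open>s'\<close>; nothing relates them.
\<close>

definition sufficient_decrease ::
  "(real^'n \<Rightarrow> 's \<Rightarrow> real) \<Rightarrow> real \<Rightarrow> real \<Rightarrow> real^'n \<Rightarrow> real \<Rightarrow> real^'n \<Rightarrow> real^'n \<Rightarrow> 's \<Rightarrow> 's \<Rightarrow> bool"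
  where "sufficient_decrease f c1 epsf x \<alpha> d g s s' \<longleftrightarrow>
           f (x + \<alpha> *\<^sub>R d) s' \<le> f x s + c1 * \<alpha> * (d \<bullet> g) + 2 * epsf"

primrec line_search ::
  "(real^'n \<Rightarrow> 's \<Rightarrow> real) \<Rightarrow> real \<Rightarrow> real \<Rightarrow> real \<Rightarrow> real^'n \<Rightarrow> real \<Rightarrow>
   (nat \<Rightarrow> real^'n) \<Rightarrow> (nat \<Rightarrow> 's) \<Rightarrow> (nat \<Rightarrow> 's) \<Rightarrow> nat \<Rightarrow> (real^'n) \<times> real"
  where
    "line_search f c1 \<tau> epsf x0 \<alpha>0 g s s' 0 = (x0, \<alpha>0)"
  | "line_search f c1 \<tau> epsf x0 \<alpha>0 g s s' (Suc k) =
       (let (x, \<alpha>) = line_search f c1 \<tau> epsf x0 \<alpha>0 g s s' k; d = - g k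
        in if sufficient_decrease f c1 epsf x \<alpha> d (g k) (s k) (s' k)
           then (x + \<alpha> *\<^sub>R d, inverse \<tau> * \<alpha>)
           else (x, \<tau> * \<alpha>))"

text \<open>
  The random iterates. The gradient estimates \<open>G\<close> and the noise \<open>\<Xi>\<close>, \<open>\<Xi>'\<close> are arbitrary
  processes on the sample space, so the estimate at iteration \<open>k\<close> may depend on the
  current iterate and on the whole past.
\<close>

definition iterate ::
  "(real^'n \<Rightarrow> 's \<Rightarrow> real) \<Rightarrow> real \<Rightarrow> real \<Rightarrow> real \<Rightarrow> real^'n \<Rightarrow> real \<Rightarrow>
   (nat \<Rightarrow> 'w \<Rightarrow> real^'n) \<Rightarrow> (nat \<Rightarrow> 'w \<Rightarrow> 's) \<Rightarrow> (nat \<Rightarrow> 'w \<Rightarrow> 's) \<Rightarrow> nat \<Rightarrow> 'w \<Rightarrow> real^'n"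
  where "iterate f c1 \<tau> epsf x0 \<alpha>0 G \<Xi> \<Xi>' k \<omega> =
    fst (line_search f c1 \<tau> epsf x0 \<alpha>0 (\<lambda>i. G i \<omega>) (\<lambda>i. \<Xi> i \<omega>) (\<lambda>i. \<Xi>' i \<omega>) k)"

text \<open>
  \<open>history P S G \<Xi> \<Xi>' k\<close> is the sigma-algebra generated by the gradient estimates and all noise
  realizations of iterations \<open>0, \<dots>, k - 1\<close>. It is trivial for \<open>k = 0\<close>.
\<close>

definition history ::
  "'w measure \<Rightarrow> 's measure \<Rightarrow> (nat \<Rightarrow> 'w \<Rightarrow> real^'n) \<Rightarrow> (nat \<Rightarrow> 'w \<Rightarrow> 's) \<Rightarrow> (nat \<Rightarrow> 'w \<Rightarrow> 's) \<Rightarrow>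
   nat \<Rightarrow> 'w measure"
  where "history P S G \<Xi> \<Xi>' k =
    vimage_algebra (space P) (\<lambda>\<omega>. \<lambda>i\<in>{..<k}. (G i \<omega>, \<Xi> i \<omega>, \<Xi>' i \<omega>))
      (\<Pi>\<^sub>M i\<in>{..<k}. borel \<Otimes>\<^sub>M S \<Otimes>\<^sub>M S)"

text \<open>
  A conditional probability is the conditional expectation of an indicator. It is determined
  only up to null sets, hence the almost-everywhere quantifier.
\<close>

definition sufficiently_accurate ::
  "'w measure \<Rightarrow> (nat \<Rightarrow> 'w measure) \<Rightarrow> (real^'n \<Rightarrow> real^'n) \<Rightarrow>
   (nat \<Rightarrow> 'w \<Rightarrow> real^'n) \<Rightarrow> (nat \<Rightarrow> 'w \<Rightarrow> real^'n) \<Rightarrow> real \<Rightarrow> real \<Rightarrow> bool"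
  where "sufficiently_accurate P F grad X G \<theta> \<delta> \<longleftrightarrow>
    (\<forall>k. AE \<omega> in P.
       real_cond_exp P (F k)
         (indicator {\<omega> \<in> space P. norm (G k \<omega> - grad (X k \<omega>)) \<le> \<theta> * norm (grad (X k \<omega>))}) \<omega>
       \<ge> 1 - \<delta>)"

text \<open>The first hitting time of accuracy \<open>\<epsilon>\<close>; it is \<open>\<infinity>\<close> if the accuracy is never reached.\<close>

definition hitting_index ::
  "('a \<Rightarrow> real) \<Rightarrow> real \<Rightarrow> (nat \<Rightarrow> 'w \<Rightarrow> 'a) \<Rightarrow> real \<Rightarrow> 'w \<Rightarrow> enat"
  where "hitting_index \<phi> \<phi>star X \<epsilon> \<omega> = (INF k \<in> {k. \<phi> (X k \<omega>) - \<phi>star \<le> \<epsilon>}. enat k)"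

definition step_threshold :: "real \<Rightarrow> real \<Rightarrow> real \<Rightarrow> real"
  where "step_threshold L \<theta> c1 = 2 * (1 - 2 * \<theta> - c1 * (1 - \<theta>)) / (L * (1 - \<theta>))"

definition rate_const :: "real \<Rightarrow> real \<Rightarrow> real \<Rightarrow> real \<Rightarrow> real"
  where "rate_const L D \<theta> c1 = 4 * L * D\<^sup>2 / (c1 * (1 - \<theta>) * (1 - 2 * \<theta> - c1 * (1 - \<theta>)))"

end

theory Submission
  imports Defs
begin

text \<open>
  Write \<open>\<Delta>\<^sub>k = \<phi> (X\<^sub>k) - \<phi>\<^sup>*\<close> and \<open>\<alpha>\<^sub>k = abar * \<tau>\<close> to the power \<open>- m\<^sub>k\<close>. The potential
  \<open>W\<^sub>k = M * (1 / \<epsilon> - 1 / \<Delta>\<^sub>k) + v (m\<^sub>k)\<close>, with \<open>v m = m\<close> for \<open>m \<ge> 0\<close> and \<open>v m = - (1 + 2\<gamma>) m\<close>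
  for \<open>m < 0\<close>, drops by at least 1 at every iteration with an accurate gradient and rises by at
  most \<open>1 + 2\<gamma>\<close> at any other, as long as \<open>\<Delta>\<close> stays above \<open>\<epsilon>\<close>. As \<open>W \<ge> 0\<close> up to the last iteration
  before \<open>N\<^sub>\<epsilon>\<close>, the stopped number of iterations is at most \<open>W\<^sub>0 + 1\<close> plus \<open>2 + 2\<gamma>\<close> times the
  number of inaccurate iterations. The expectation of the latter is at most \<open>\<delta> E[N\<^sub>\<epsilon>]\<close>, because
  \<open>N\<^sub>\<epsilon> > k\<close> is decided by the history before iteration \<open>k\<close>. Hence
  \<open>(1 - 2\<delta>(1 + \<gamma>)) E[N\<^sub>\<epsilon>] \<le> W\<^sub>0 + 1 \<le> 2 W\<^sub>0\<close>, and \<open>2 / (1 - 2\<delta>(1 + \<gamma>))\<close> is at most \<open>1 - \<gamma>\<close> times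
  the leading factor of the claim.
\<close>

section \<open>Inequalities for convex and smooth functions\<close>

lemma has_real_derivative_along_line:
  fixes \<phi> :: "'a::euclidean_space \<Rightarrow> real"
  assumes "GDERIV \<phi> (x + t *\<^sub>R d) :> v"
  shows "((\<lambda>t. \<phi> (x + t *\<^sub>R d)) has_real_derivative (d \<bullet> v)) (at t)"
proof -
  have *: "(\<phi> has_derivative (\<lambda>h. h \<bullet> v)) (at (x + t *\<^sub>R d))"
    using assms by (simp add: gderiv_def)
  have "((\<lambda>t. x + t *\<^sub>R d) has_derivative (\<lambda>h. h *\<^sub>R d)) (at t)"
    by (auto intro!: derivative_eq_intros)
  from has_derivative_compose[OF this *] show ?thesis
    unfolding has_field_derivative_def by (simp add: mult.commute[of _ "d \<bullet> v"])
qed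

text \<open>Restricting \<open>\<phi>\<close> to the line through \<open>x\<close> and
  \<open>y\<close> reduces the claim to the tangent inequality for a convex function of one real
  variable, with the tangent at 0 evaluated at 1.\<close>

lemma convex_on_above_gradient:
  fixes \<phi> :: "'a::euclidean_space \<Rightarrow> real"
  assumes convex: "convex_on UNIV \<phi>" and grad: "GDERIV \<phi> x :> v"
  shows "\<phi> x + v \<bullet> (y - x) \<le> \<phi> y"
proof -
  let ?h = "\<lambda>t. \<phi> (x + t *\<^sub>R (y - x))"
  have "convex_on UNIV ?h"
  proof (rule convex_onI)
    fix t a b :: real
    assume t: "0 < t" "t < 1"
    have "x + ((1 - t) *\<^sub>R a + t *\<^sub>R b) *\<^sub>R (y - x)
        = (1 - t) *\<^sub>R (x + a *\<^sub>R (y - x)) + t *\<^sub>R (x + b *\<^sub>R (y - x))"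
      by (simp add: algebra_simps)
    then show "?h ((1 - t) *\<^sub>R a + t *\<^sub>R b) \<le> (1 - t) * ?h a + t * ?h b"
      using convex_onD[OF convex, of t] t by simp
  qed simp
  moreover have "(?h has_real_derivative ((y - x) \<bullet> v)) (at 0)"
    using has_real_derivative_along_line[of \<phi> x 0 "y - x" v] grad by simp
  ultimately have "?h 1 - ?h 0 \<ge> ((y - x) \<bullet> v) * (1 - 0)"
    by (intro convex_on_imp_above_tangent[where A = UNIV]) auto
  then show ?thesis by (simp add: inner_commute)
qed

text \<open>Along the segment, \<open>\<phi>\<close> minus its quadratic upper model has derivative
  at most 0, by Cauchy-Schwarz and the Lipschitz bound. Monotonicity on \<open>[0, 1]\<close> thus
  takes the place of integration.\<close>

lemma lipschitz_gradient_upper_bound: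
  fixes \<phi> :: "'a::euclidean_space \<Rightarrow> real"
  assumes grad: "\<And>x. GDERIV \<phi> x :> grad x" and lip: "L-lipschitz_on UNIV grad"
  shows "\<phi> (x + d) \<le> \<phi> x + grad x \<bullet> d + L / 2 * (d \<bullet> d)"
proof -
  let ?h = "\<lambda>t. \<phi> (x + t *\<^sub>R d) - t * (grad x \<bullet> d) - L / 2 * t\<^sup>2 * (d \<bullet> d)"
  have "?h 1 \<le> ?h 0"
  proof (rule DERIV_nonpos_imp_nonincreasing[of 0 1 ?h])
    fix t :: real
    assume t: "0 \<le> t" "t \<le> 1"
    let ?D = "d \<bullet> grad (x + t *\<^sub>R d) - grad x \<bullet> d - L * t * (d \<bullet> d)"
    have "(?h has_real_derivative ?D) (at t)"
      by (rule derivative_eq_intros has_real_derivative_along_line grad refl | simp)+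
    moreover have "?D \<le> 0"
    proof -
      have "norm (grad (x + t *\<^sub>R d) - grad x) \<le> L * norm (t *\<^sub>R d)"
        using lipschitz_onD[OF lip, of "x + t *\<^sub>R d" x] by (simp add: dist_norm)
      then have "d \<bullet> (grad (x + t *\<^sub>R d) - grad x) \<le> norm d * (L * (t * norm d))"
        using t by (intro order_trans[OF norm_cauchy_schwarz] mult_left_mono) auto
      then show ?thesis
        by (simp add: inner_diff_right inner_commute[of _ d] dot_square_norm power2_eq_square mult_ac)
    qed
    ultimately show "\<exists>y. (?h has_real_derivative y) (at t) \<and> y \<le> 0" by blast
  qed simp
  then show ?thesis by simp
qed

lemma accurate_gradient_norm:
  assumes "norm (g - v) \<le> \<theta> * norm v"
  shows "(1 - \<theta>) * norm v \<le> norm g"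
  using assms norm_triangle_ineq2[of v g] by (simp add: norm_minus_commute algebra_simps)

text \<open>The error \<open>g - v\<close> has norm at most \<open>\<theta> * norm v\<close>, hence
  at most \<open>\<theta> / (1 - \<theta>) * norm g\<close>. Cauchy-Schwarz against \<open>g\<close>
  gives the bound, kept free of division.\<close>

lemma accurate_gradient_inner:
  fixes g v :: "'a::real_inner"
  assumes acc: "norm (g - v) \<le> \<theta> * norm v" and "0 \<le> \<theta>" "\<theta> < 1"
  shows "(1 - 2 * \<theta>) * (g \<bullet> g) \<le> (1 - \<theta>) * (v \<bullet> g)"
proof -
  have "(g - v) \<bullet> g \<le> (\<theta> * norm v) * norm g"
    using order_trans[OF norm_cauchy_schwarz mult_right_mono[OF acc]] by simp
  then have "(1 - \<theta>) * ((g - v) \<bullet> g) \<le> (1 - \<theta>) * ((\<theta> * norm v) * norm g)"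
    using \<open>\<theta> < 1\<close> by (intro mult_left_mono) auto
  also have "\<dots> = \<theta> * ((1 - \<theta>) * norm v) * norm g" by simp
  also have "\<dots> \<le> \<theta> * norm g * norm g"
    using accurate_gradient_norm[OF acc] \<open>0 \<le> \<theta>\<close> by (intro mult_right_mono mult_left_mono) auto
  finally show ?thesis
    by (simp add: inner_diff_left dot_square_norm power2_eq_square algebra_simps)
qed

lemma diff_inverse_le:
  fixes a b :: real
  assumes "0 < M" "0 < a" "0 < b" and "M * (b - a) \<le> r * (a * b)"
  shows "M / a - M / b \<le> r"
  using assms by (simp add: field_simps)

text \<open>\<open>W\<close> is controlled only at indices below \<open>n\<close>, since the gap may
  fall to \<open>\<epsilon>\<close> at index \<open>n\<close> itself. The last iteration is
  therefore counted separately, by the summand 1.\<close>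

lemma telescoping_count:
  fixes W :: "nat \<Rightarrow> real"
  assumes step: "\<And>k. Suc k < n \<Longrightarrow> W (Suc k) \<le> W k - 1 + b * of_bool (bad k)"
    and nonneg: "\<And>k. k < n \<Longrightarrow> 0 \<le> W k" "0 \<le> W 0" and "0 \<le> b"
  shows "real n \<le> W 0 + 1 + b * (\<Sum>k<n. of_bool (bad k))"
proof (cases n)
  case 0
  then show ?thesis using nonneg by simp
next
  case (Suc j)
  have "i \<le> j \<Longrightarrow> W i \<le> W 0 - real i + b * (\<Sum>k<i. of_bool (bad k))" for i
  proof (induction i)
    case (Suc i)
    then show ?case
      using step[of i] \<open>n = Suc j\<close> by (simp add: algebra_simps)
  qed simp
  from this[of j] nonneg(1)[of j] Suc have "real j \<le> W 0 + b * (\<Sum>k<j. of_bool (bad k))"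
    by simp
  also have "\<dots> \<le> W 0 + b * (\<Sum>k<n. of_bool (bad k))"
    using Suc \<open>0 \<le> b\<close> by (intro add_left_mono mult_left_mono sum_mono2) auto
  finally show ?thesis using Suc by simp
qed

section \<open>Deterministic analysis of a single run\<close>

locale noisy_convex_line_search =
  fixes S :: "'s measure" and \<phi> :: "real^'n \<Rightarrow> real" and grad :: "real^'n \<Rightarrow> real^'n"
    and f :: "real^'n \<Rightarrow> 's \<Rightarrow> real" and xstar :: "real^'n"
    and L D \<tau> c1 epsf \<alpha>0 \<theta> \<gamma> \<epsilon> :: real and c :: nat
  assumes \<alpha>0_pos: "0 < \<alpha>0" and \<tau>_pos: "0 < \<tau>" and \<tau>_le1: "\<tau> \<le> 1"
    and c1_pos: "0 < c1" and c1_less1: "c1 < 1" and epsf_nonneg: "0 \<le> epsf"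
    and convex: "convex_on UNIV \<phi>"
    and grad: "\<And>x. GDERIV \<phi> x :> grad x"
    and L_pos: "0 < L" and lipschitz: "L-lipschitz_on UNIV grad"
    and noise: "\<And>x s. s \<in> space S \<Longrightarrow> \<bar>f x s - \<phi> x\<bar> \<le> epsf"
    and D_pos: "0 < D"
    and \<theta>_nonneg: "0 \<le> \<theta>" and \<theta>_less: "\<theta> < (1 - c1) / (2 - c1)"
    and \<gamma>_pos: "0 < \<gamma>" and \<gamma>_less1: "\<gamma> < 1"
    and \<epsilon>_pos: "0 < \<epsilon>"
    and \<epsilon>_noise: "8 * epsf * L * D\<^sup>2 / (\<gamma> * c1 * (1 - \<theta>) * (1 - 2 * \<theta> - c1 * (1 - \<theta>))) < \<epsilon>\<^sup>2"
    and threshold: "step_threshold L \<theta> c1 = \<tau> ^ c * \<alpha>0"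
begin

abbreviation "abar \<equiv> step_threshold L \<theta> c1"
abbreviation "M \<equiv> rate_const L D \<theta> c1"

lemma \<theta>_less1: "\<theta> < 1"
proof -
  have "\<theta> * (2 - c1) < 1 - c1"
    using \<theta>_less c1_less1 by (simp add: pos_less_divide_eq)
  moreover have "\<theta> \<le> \<theta> * (2 - c1)"
    using \<theta>_nonneg c1_less1 mult_left_mono[of 1 "2 - c1" \<theta>] by simp
  ultimately show ?thesis using c1_pos by linarith
qed

lemma margin_pos: "0 < 1 - 2 * \<theta> - c1 * (1 - \<theta>)"
proof -
  have "\<theta> * (2 - c1) < 1 - c1"
    using \<theta>_less c1_less1 by (simp add: pos_less_divide_eq)
  then show ?thesis by (simp add: algebra_simps)
qed

lemma abar_pos: "0 < abar"
  using \<theta>_less1 margin_pos L_pos by (simp add: step_threshold_def)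

lemma M_pos: "0 < M"
  using \<theta>_less1 margin_pos L_pos D_pos c1_pos by (simp add: rate_const_def)

text \<open>The margin \<open>1 - 2 * \<theta> - c1 * (1 - \<theta>)\<close> cancels between the two
  constants. The remaining 8 sets the progress of an accurate step of length at least
  \<open>abar\<close>.\<close>

lemma M_abar: "M * (c1 * abar * (1 - \<theta>)\<^sup>2) = 8 * D\<^sup>2"
proof -
  have "4 * L * D\<^sup>2 / (c1 * u * e) * (c1 * (2 * e / (L * u)) * u\<^sup>2) = 8 * D\<^sup>2"
    if "0 < u" "0 < e" for u e
    using that L_pos c1_pos by (simp add: field_simps power2_eq_square)
  then show ?thesis
    using \<theta>_less1 margin_pos unfolding rate_const_def step_threshold_def by (metis diff_gt_0_iff_gt)
qed

text \<open>The lower bound on \<open>\<epsilon>\<^sup>2\<close> expressed through \<open>M\<close>.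
  It turns the noise \<open>4 * epsf\<close> of a successful step into a potential loss of at most
  \<open>2 * \<gamma>\<close>.\<close>

lemma M_noise: "2 * M * epsf \<le> \<gamma> * \<epsilon>\<^sup>2"
proof -
  have "8 * epsf * L * D\<^sup>2 / (\<gamma> * c1 * (1 - \<theta>) * (1 - 2 * \<theta> - c1 * (1 - \<theta>))) = 2 * M * epsf / \<gamma>"
    by (simp add: rate_const_def mult_ac)
  with \<epsilon>_noise have "2 * M * epsf / \<gamma> < \<epsilon>\<^sup>2" by (simp only:)
  then show ?thesis using \<gamma>_pos by (simp add: pos_divide_less_eq mult.commute)
qed

text \<open>The threshold \<open>abar\<close> is chosen so that the quadratic upper bound yields a
  true decrease of at least \<open>c1 * \<alpha> * (g \<bullet> g)\<close>. The two noisy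
  evaluations then cost at most \<open>2 * epsf\<close>, which is exactly the slack of the
  test.\<close>

lemma accurate_short_step_successful:
  assumes acc: "norm (g - grad x) \<le> \<theta> * norm (grad x)"
    and \<alpha>: "0 < \<alpha>" "\<alpha> \<le> abar" and s: "s \<in> space S" "s' \<in> space S"
  shows "sufficient_decrease f c1 epsf x \<alpha> (- g) g s s'"
proof -
  have "L * (1 - \<theta>) * \<alpha> \<le> L * (1 - \<theta>) * abar"
    using \<alpha> L_pos \<theta>_less1 by (intro mult_left_mono) auto
  also have "\<dots> = 2 * (1 - 2 * \<theta> - c1 * (1 - \<theta>))"
    using L_pos \<theta>_less1 by (simp add: step_threshold_def)
  finally have "(L * (1 - \<theta>) * \<alpha>) * (g \<bullet> g) \<le> (2 * (1 - 2 * \<theta> - c1 * (1 - \<theta>))) * (g \<bullet> g)"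
    by (intro mult_right_mono) auto
  moreover have "(1 - \<theta>) * (L / 2 * \<alpha> * (g \<bullet> g) + c1 * (g \<bullet> g))
      = (L * (1 - \<theta>) * \<alpha>) * (g \<bullet> g) / 2 + c1 * (1 - \<theta>) * (g \<bullet> g)"
    by (simp add: field_simps)
  ultimately have "(1 - \<theta>) * (L / 2 * \<alpha> * (g \<bullet> g) + c1 * (g \<bullet> g)) \<le> (1 - \<theta>) * (grad x \<bullet> g)"
    using accurate_gradient_inner[OF acc \<theta>_nonneg \<theta>_less1] by (simp add: left_diff_distrib)
  then have "L / 2 * \<alpha> * (g \<bullet> g) + c1 * (g \<bullet> g) \<le> grad x \<bullet> g"
    using \<theta>_less1 by simp
  from mult_left_mono[OF this, of \<alpha>]
  have "\<alpha> * (L / 2 * \<alpha> * (g \<bullet> g)) + c1 * \<alpha> * (g \<bullet> g) \<le> \<alpha> * (grad x \<bullet> g)"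
    using \<alpha> by (simp add: algebra_simps)
  with lipschitz_gradient_upper_bound[of \<phi> grad L x "\<alpha> *\<^sub>R (- g)", OF grad lipschitz]
  have "\<phi> (x + \<alpha> *\<^sub>R (- g)) \<le> \<phi> x - c1 * \<alpha> * (g \<bullet> g)"
    by (simp add: mult_ac)
  with noise[OF s(1), of x] noise[OF s(2), of "x + \<alpha> *\<^sub>R (- g)"] show ?thesis
    by (simp add: sufficient_decrease_def)
qed

text \<open>Of the \<open>4 * epsf\<close>, one half is the slack of the test and the other half is
  the error of the two evaluations.\<close>

lemma successful_decrease:
  assumes "sufficient_decrease f c1 epsf x \<alpha> (- g) g s s'" "s \<in> space S" "s' \<in> space S"
  shows "\<phi> (x + \<alpha> *\<^sub>R (- g)) \<le> \<phi> x - c1 * \<alpha> * (g \<bullet> g) + 4 * epsf"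
  using assms(1) noise[OF assms(2), of x] noise[OF assms(3), of "x + \<alpha> *\<^sub>R (- g)"]
  by (simp add: sufficient_decrease_def)

text \<open>The difference of reciprocals is \<open>(b - a) / (a * b)\<close>, where the numerator
  is at most \<open>4 * epsf\<close> and the denominator exceeds
  \<open>\<epsilon>\<^sup>2\<close>.\<close>

lemma gap_loss:
  assumes "\<epsilon> < a" "\<epsilon> < b" and "b \<le> a + 4 * epsf"
  shows "M / a - M / b \<le> 2 * \<gamma>"
proof (rule diff_inverse_le)
  have "M * (b - a) \<le> M * (4 * epsf)"
    using assms M_pos by (intro mult_left_mono) auto
  also have "\<dots> = 2 * (2 * M * epsf)" by simp
  also have "\<dots> \<le> 2 * (\<gamma> * \<epsilon>\<^sup>2)"
    using M_noise by (rule mult_left_mono) simp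
  also have "\<dots> = 2 * \<gamma> * \<epsilon>\<^sup>2" by simp
  also have "\<dots> \<le> 2 * \<gamma> * (a * b)"
    using assms \<gamma>_pos \<epsilon>_pos unfolding power2_eq_square
    by (intro mult_left_mono mult_mono) auto
  finally show "M * (b - a) \<le> 2 * \<gamma> * (a * b)" .
qed (use assms M_pos \<epsilon>_pos in auto)

text \<open>Convexity bounds the gap by \<open>norm (grad x) * D\<close>, and accuracy bounds
  \<open>norm (grad x)\<close> by a multiple of \<open>norm g\<close>. So
  \<open>g \<bullet> g\<close> is at least of the order of the squared gap, and the decrease of the
  reciprocal gap is bounded below by a constant.\<close>

lemma gap_gain:
  assumes acc: "norm (g - grad x) \<le> \<theta> * norm (grad x)"
    and \<alpha>: "abar \<le> \<alpha>" and x: "norm (x - xstar) \<le> D"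
    and a: "\<epsilon> < \<phi> x - \<phi> xstar" and b: "\<epsilon> < b"
    and decr: "b \<le> \<phi> x - \<phi> xstar - c1 * \<alpha> * (g \<bullet> g) + 4 * epsf"
  shows "M / (\<phi> x - \<phi> xstar) - M / b \<le> - 2"
proof -
  define a where "a = \<phi> x - \<phi> xstar"
  have "a > 0" "\<epsilon> < a" "b > 0" using assms \<epsilon>_pos by (auto simp: a_def)
  have "a \<le> grad x \<bullet> (x - xstar)"
    using convex_on_above_gradient[OF convex grad, of x xstar]
    by (simp add: a_def inner_diff_right)
  also have "\<dots> \<le> norm (grad x) * D"
    using x by (intro order_trans[OF norm_cauchy_schwarz] mult_left_mono) auto
  finally have "(1 - \<theta>) * a \<le> (1 - \<theta>) * norm (grad x) * D"
    using \<theta>_less1 by simp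
  also have "\<dots> \<le> norm g * D"
    using accurate_gradient_norm[OF acc] D_pos by (intro mult_right_mono) auto
  finally have "((1 - \<theta>) * a)\<^sup>2 \<le> (norm g * D)\<^sup>2"
    using \<theta>_less1 \<open>a > 0\<close> by (intro power_mono) auto
  then have g: "(1 - \<theta>)\<^sup>2 * a\<^sup>2 \<le> (g \<bullet> g) * D\<^sup>2"
    by (simp add: power_mult_distrib dot_square_norm)
  have "8 * a\<^sup>2 * D\<^sup>2 = M * (c1 * abar) * ((1 - \<theta>)\<^sup>2 * a\<^sup>2)"
    using M_abar by (simp add: mult_ac)
  also have "\<dots> \<le> M * (c1 * \<alpha>) * ((g \<bullet> g) * D\<^sup>2)"
  proof (rule mult_mono[OF _ g])
    show "M * (c1 * abar) \<le> M * (c1 * \<alpha>)"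
      using \<alpha> M_pos c1_pos by simp
  qed (use \<alpha> M_pos c1_pos abar_pos in auto)
  finally have "8 * a\<^sup>2 \<le> M * (c1 * \<alpha> * (g \<bullet> g))"
    using D_pos by (simp add: mult_ac)
  moreover have "M * b \<le> M * (a - c1 * \<alpha> * (g \<bullet> g) + 4 * epsf)"
    using decr M_pos by (simp add: a_def)
  moreover have "2 * \<gamma> * \<epsilon>\<^sup>2 \<le> 2 * a\<^sup>2"
    using \<open>\<epsilon> < a\<close> \<epsilon>_pos \<gamma>_pos \<gamma>_less1 by (intro mult_mono power_mono) auto
  \<comment> \<open>Progress of at least \<open>8 * a\<^sup>2\<close> against noise of at most
    \<open>2 * \<gamma> * \<epsilon>\<^sup>2\<close>, which is below
    \<open>2 * a\<^sup>2\<close>.\<close>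
  ultimately have drop: "M * (b - a) \<le> - 6 * a\<^sup>2"
    using M_noise by (simp add: algebra_simps)
  then have "M * (b - a) \<le> 0"
    using zero_le_power2[of a] by linarith
  then have "b \<le> a"
    using M_pos by (simp add: mult_le_0_iff)
  then have "a * b \<le> a\<^sup>2"
    using \<open>a > 0\<close> by (simp add: power2_eq_square)
  with drop have "M * (b - a) \<le> - 2 * (a * b)"
    using zero_le_power2[of a] by linarith
  then show ?thesis
    using diff_inverse_le[OF M_pos \<open>a > 0\<close> \<open>b > 0\<close>] by (simp add: a_def)
qed

text \<open>
  \<open>level \<alpha>\<close> is the \<open>m\<close> with \<open>\<alpha> = abar * \<tau> powr (- m)\<close>; for \<open>\<tau> = 1\<close> the junk value
  \<open>log 1 x = 0\<close> is the right one.
\<close>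

definition level :: "real \<Rightarrow> real"
  where "level \<alpha> = log \<tau> (abar / \<alpha>)"

text \<open>
  The slope \<open>1 + 2\<gamma>\<close> below the threshold pays for the noise of a successful short step.
\<close>

definition level_cost :: "real \<Rightarrow> real"
  where "level_cost m = (if 0 \<le> m then m else - (1 + 2 * \<gamma>) * m)"

definition potential :: "real^'n \<Rightarrow> real \<Rightarrow> real"
  where "potential x \<alpha> = M * (1 / \<epsilon> - 1 / (\<phi> x - \<phi> xstar)) + level_cost (level \<alpha>)"

lemma level_cost_nonneg: "0 \<le> level_cost m"
  using \<gamma>_pos by (auto simp: level_cost_def intro!: mult_nonpos_nonpos)

lemma potential_nonneg:
  assumes "\<epsilon> \<le> \<phi> x - \<phi> xstar"
  shows "0 \<le> potential x \<alpha>"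
proof -
  have "1 / (\<phi> x - \<phi> xstar) \<le> 1 / \<epsilon>"
    using assms \<epsilon>_pos by (intro divide_left_mono mult_pos_pos) auto
  then show ?thesis
    using M_pos level_cost_nonneg by (auto simp: potential_def)
qed

text \<open>The truth value makes one formula cover the constant step size as well, where the level
  stays put.\<close>

lemma level_up:
  assumes "0 < \<alpha>"
  shows "level (inverse \<tau> * \<alpha>) = level \<alpha> + of_bool (\<tau> < 1)"
proof (cases "\<tau> = 1")
  case False
  then show ?thesis
    using \<tau>_pos \<tau>_le1 abar_pos assms
    by (simp add: level_def log_def ln_div ln_mult ln_inverse add_divide_distrib diff_divide_distrib)
qed (simp add: level_def)

lemma level_down:
  assumes "0 < \<alpha>"
  shows "level (\<tau> * \<alpha>) = level \<alpha> - of_bool (\<tau> < 1)"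
  using level_up[of "\<tau> * \<alpha>"] \<tau>_pos assms by (simp add: mult.assoc[symmetric])

lemma level_initial: "level \<alpha>0 = real c * of_bool (\<tau> < 1)"
proof (cases "\<tau> = 1")
  case False
  then show ?thesis
    using threshold \<alpha>0_pos \<tau>_pos \<tau>_le1 by (simp add: level_def log_nat_power)
next
  case True
  then show ?thesis unfolding level_def log_def by simp
qed

lemma level_nonneg_iff:
  assumes "0 < \<alpha>" "\<tau> < 1"
  shows "0 \<le> level \<alpha> \<longleftrightarrow> abar \<le> \<alpha>"
proof -
  have "0 \<le> level \<alpha> \<longleftrightarrow> ln (abar / \<alpha>) \<le> 0"
    using \<tau>_pos assms by (simp add: level_def log_def zero_le_divide_iff)
  also have "\<dots> \<longleftrightarrow> abar \<le> \<alpha>"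
    using assms abar_pos by simp
  finally show ?thesis .
qed

lemma level_nonpos_iff:
  assumes "0 < \<alpha>" "\<tau> < 1"
  shows "level \<alpha> \<le> 0 \<longleftrightarrow> \<alpha> \<le> abar"
proof -
  have "level \<alpha> \<le> 0 \<longleftrightarrow> 0 \<le> ln (abar / \<alpha>)"
    using \<tau>_pos assms by (simp add: level_def log_def divide_le_0_iff)
  also have "\<dots> \<longleftrightarrow> \<alpha> \<le> abar"
    using assms abar_pos by simp
  finally show ?thesis .
qed

text \<open>Integrality is what prevents a unit step from jumping across the kink of
  \<open>level_cost\<close> at 0. Each step then runs along a single linear piece.\<close>

lemma level_cost_step:
  assumes "m \<in> \<int>"
  shows "level_cost (m + 1) \<le> level_cost m + 1"
    and "0 < m \<Longrightarrow> level_cost (m - 1) = level_cost m - 1"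
    and "level_cost (m - 1) \<le> level_cost m + (1 + 2 * \<gamma>)"
    and "m < 0 \<Longrightarrow> level_cost (m + 1) = level_cost m - (1 + 2 * \<gamma>)"
proof -
  obtain i where m: "m = of_int i" using assms by (auto elim: Ints_cases)
  \<comment> \<open>In each of these cases the signs of \<open>m - 1\<close>, \<open>m\<close> and
    \<open>m + 1\<close> are fixed.\<close>
  consider "i \<le> - 2" | "i = - 1" | "i = 0" | "1 \<le> i" by linarith
  then have "m \<le> - 2 \<or> m = - 1 \<or> m = 0 \<or> 1 \<le> m"
    unfolding m using of_int_le_iff[of i "- 2", where ?'a = real] by cases auto
  then show "level_cost (m + 1) \<le> level_cost m + 1"
    and "0 < m \<Longrightarrow> level_cost (m - 1) = level_cost m - 1"
    and "level_cost (m - 1) \<le> level_cost m + (1 + 2 * \<gamma>)"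
    and "m < 0 \<Longrightarrow> level_cost (m + 1) = level_cost m - (1 + 2 * \<gamma>)"
    using \<gamma>_pos by (auto simp: level_cost_def algebra_simps)
qed

text \<open>The gap term and the level term are balanced against each other: whichever of them rises
  in an accurate iteration is outweighed by the other.\<close>

lemma potential_step:
  fixes g :: "real^'n"
  defines "succ \<equiv> \<lambda>x \<alpha> s s'. sufficient_decrease f c1 epsf x \<alpha> (- g) g s s'"
  defines "acc \<equiv> \<lambda>x. norm (g - grad x) \<le> \<theta> * norm (grad x)"
  assumes \<alpha>: "0 < \<alpha>" and int: "level \<alpha> \<in> \<int>" and one: "\<tau> = 1 \<Longrightarrow> \<alpha> = abar"
    and x: "norm (x - xstar) \<le> D" and s: "s \<in> space S" "s' \<in> space S"
    and gap: "\<epsilon> < \<phi> x - \<phi> xstar"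
    and step: "(x', \<alpha>') = (if succ x \<alpha> s s' then (x + \<alpha> *\<^sub>R (- g), inverse \<tau> * \<alpha>) else (x, \<tau> * \<alpha>))"
    and gap': "\<epsilon> < \<phi> x' - \<phi> xstar"
  shows "potential x' \<alpha>' \<le> potential x \<alpha> - 1 + (2 + 2 * \<gamma>) * of_bool (\<not> acc x)"
proof -
  define a where "a = \<phi> x - \<phi> xstar"
  define b where "b = \<phi> x' - \<phi> xstar"
  define m where "m = level \<alpha>"
  have diff: "potential x' \<alpha>' - potential x \<alpha>
      = (M / a - M / b) + (level_cost (level \<alpha>') - level_cost m)"
    by (simp add: potential_def a_def b_def m_def algebra_simps)
  have loss: "M / a - M / b \<le> 2 * \<gamma>" if "succ x \<alpha> s s'"
  proof (rule gap_loss)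
    have "0 \<le> c1 * \<alpha> * (g \<bullet> g)" using c1_pos \<alpha> by simp
    then show "b \<le> a + 4 * epsf"
      using successful_decrease[of x \<alpha> g s s'] that s step by (simp add: succ_def a_def b_def)
  qed (use gap gap' in \<open>auto simp: a_def b_def\<close>)
  have gain: "M / a - M / b \<le> - 2" if "succ x \<alpha> s s'" "acc x" "abar \<le> \<alpha>"
    unfolding a_def
  proof (rule gap_gain[of g x \<alpha>])
    show "b \<le> \<phi> x - \<phi> xstar - c1 * \<alpha> * (g \<bullet> g) + 4 * epsf"
      using successful_decrease[of x \<alpha> g s s'] that s step by (simp add: succ_def b_def)
  qed (use that x gap gap' in \<open>auto simp: acc_def b_def\<close>)
  have short: "succ x \<alpha> s s'" if "acc x" "\<alpha> \<le> abar"
    using accurate_short_step_successful[of g x \<alpha> s s'] that \<alpha> s by (simp add: acc_def succ_def)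
  have fail: "M / a - M / b = 0" if "\<not> succ x \<alpha> s s'"
    using that step by (simp add: a_def b_def)
  have up: "level \<alpha>' = m + of_bool (\<tau> < 1)" if "succ x \<alpha> s s'"
    using that step level_up[OF \<alpha>] by (simp add: m_def)
  have down: "level \<alpha>' = m - of_bool (\<tau> < 1)" if "\<not> succ x \<alpha> s s'"
    using that step level_down[OF \<alpha>] by (simp add: m_def)
  show ?thesis
  proof (cases "\<tau> = 1")
    \<comment> \<open>The constant step equals \<open>abar\<close>, so it is both short enough to
      succeed and long enough for \<open>gain\<close> when the gradient is accurate.\<close>
    case True
    then have "level \<alpha>' = m" using up down by (cases "succ x \<alpha> s s'") auto
    then show ?thesis
      using diff loss gain short fail one[OF True] \<gamma>_pos
      by (cases "succ x \<alpha> s s'"; cases "acc x") auto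
  next
    case False
    then have "\<tau> < 1" using \<tau>_le1 by simp
    note cost = level_cost_step[OF int, folded m_def]
    have nonneg: "0 \<le> m \<longleftrightarrow> abar \<le> \<alpha>" and nonpos: "m \<le> 0 \<longleftrightarrow> \<alpha> \<le> abar"
      unfolding m_def using level_nonneg_iff level_nonpos_iff \<alpha> \<open>\<tau> < 1\<close> by auto
    show ?thesis
    proof (cases "succ x \<alpha> s s'")
      \<comment> \<open>Accurate case: at \<open>m \<ge> 0\<close> the gap term falls by 2 and the
        level cost rises by at most 1; at \<open>m < 0\<close> the level cost falls by
        \<open>1 + 2 * \<gamma>\<close>, which pays for the noise loss
        \<open>2 * \<gamma>\<close>.\<close>
      case True
      then have "level \<alpha>' = m + 1" using up \<open>\<tau> < 1\<close> by simp
      then show ?thesis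
        using diff loss[OF True] gain[OF True] cost(1,4) nonneg \<gamma>_pos
        by (cases "acc x"; cases "m < 0") auto
    next
      \<comment> \<open>With an accurate gradient, failure forces \<open>\<alpha> > abar\<close>,
        that is \<open>0 < m\<close>, and the level cost falls by 1.\<close>
      case False
      then have "level \<alpha>' = m - 1" using down \<open>\<tau> < 1\<close> by simp
      then show ?thesis
        using diff fail[OF False] False short cost(2,3) nonpos \<gamma>_pos
        by (cases "acc x"; cases "0 < m") auto
    qed
  qed
qed

lemma step_size_invariant:
  fixes g x0 s s'
  defines "\<alpha> \<equiv> \<lambda>k. snd (line_search f c1 \<tau> epsf x0 \<alpha>0 g s s' k)"
  shows "0 < \<alpha> k \<and> level (\<alpha> k) \<in> \<int> \<and> (\<tau> = 1 \<longrightarrow> \<alpha> k = abar)"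
proof (induction k)
  case 0
  then show ?case
    using \<alpha>0_pos threshold level_initial by (simp add: \<alpha>_def)
next
  case (Suc k)
  have "\<alpha> (Suc k) = inverse \<tau> * \<alpha> k \<or> \<alpha> (Suc k) = \<tau> * \<alpha> k"
    by (auto simp: \<alpha>_def Let_def split: prod.split)
  with Suc show ?case
    using level_up[of "\<alpha> k"] level_down[of "\<alpha> k"] \<tau>_pos by auto
qed

text \<open>The gap at index \<open>n\<close> is left free, so that \<open>n\<close> may be the
  hitting time itself. The separate bound on the initial gap serves the case
  \<open>n = 0\<close>.\<close>

lemma iteration_count:
  fixes g x0 s s'
  defines "x \<equiv> \<lambda>k. fst (line_search f c1 \<tau> epsf x0 \<alpha>0 g s s' k)"
  assumes s: "\<And>k. s k \<in> space S" "\<And>k. s' k \<in> space S"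
    and D: "\<And>k. norm (x k - xstar) \<le> D"
    and gap0: "\<epsilon> \<le> \<phi> x0 - \<phi> xstar"
    and gap: "\<And>k. k < n \<Longrightarrow> \<epsilon> < \<phi> (x k) - \<phi> xstar"
  shows "real n \<le> potential x0 \<alpha>0 + 1 + (2 + 2 * \<gamma>) *
    (\<Sum>k<n. of_bool (\<not> norm (g k - grad (x k)) \<le> \<theta> * norm (grad (x k))))"
proof -
  define \<alpha> where "\<alpha> k = snd (line_search f c1 \<tau> epsf x0 \<alpha>0 g s s' k)" for k
  define W where "W k = potential (x k) (\<alpha> k)" for k
  have step: "(x (Suc k), \<alpha> (Suc k)) = (if sufficient_decrease f c1 epsf (x k) (\<alpha> k) (- g k) (g k) (s k) (s' k)
       then (x k + \<alpha> k *\<^sub>R (- g k), inverse \<tau> * \<alpha> k) else (x k, \<tau> * \<alpha> k))" for k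
    by (auto simp: x_def \<alpha>_def Let_def split: prod.split)
  have W0: "W 0 = potential x0 \<alpha>0" by (simp add: W_def x_def \<alpha>_def)
  show ?thesis
    unfolding W0[symmetric]
  proof (rule telescoping_count)
    fix k
    assume "Suc k < n"
    then show "W (Suc k) \<le> W k - 1 + (2 + 2 * \<gamma>) *
        of_bool (\<not> norm (g k - grad (x k)) \<le> \<theta> * norm (grad (x k)))"
      unfolding W_def
      using step_size_invariant[of x0 g s s' k]
      by (intro potential_step[OF _ _ _ D s(1)[of k] s(2)[of k] _ step[of k]])
         (auto simp: \<alpha>_def intro: gap)
  next
    show "0 \<le> W 0" using potential_nonneg gap0 by (simp add: W0)
    show "0 \<le> W k" if "k < n" for k
      using potential_nonneg gap[OF that] by (simp add: W_def)
  qed (use \<gamma>_pos in simp)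
qed

end

section \<open>From pathwise counting to expectations\<close>

text \<open>Integrating the bound over \<open>A\<close> suffices: as \<open>A\<close> belongs to
  \<open>F\<close>, the conditional expectation has the same integral over \<open>A\<close> as the
  indicator of \<open>B\<close>.\<close>

lemma (in prob_space) integral_cond_exp_lower_bound:
  assumes F: "subalgebra M F" and A: "A \<in> sets F" and B: "B \<in> events"
    and ce: "AE \<omega> in M. p \<le> real_cond_exp M F (indicator B) \<omega>"
  shows "p * prob A \<le> prob (A \<inter> B)"
proof -
  interpret finite_measure_subalgebra M F by unfold_locales (rule F)
  have A': "A \<in> events" using A F by (auto simp: subalgebra_def)
  have int: "integrable M (indicator B :: 'a \<Rightarrow> real)"
    using B by (intro integrable_real_indicator) (auto simp: less_top[symmetric])
  have "p * prob A = (\<integral>\<omega>\<in>A. p \<partial>M)"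
    using A' by (simp add: set_lebesgue_integral_def)
  also have "\<dots> \<le> (\<integral>\<omega>\<in>A. real_cond_exp M F (indicator B) \<omega> \<partial>M)"
    unfolding set_lebesgue_integral_def
  proof (rule integral_mono_AE)
    show "integrable M (\<lambda>\<omega>. indicator A \<omega> *\<^sub>R p)"
      using integrable_mult_indicator[OF A' integrable_const] .
    show "integrable M (\<lambda>\<omega>. indicator A \<omega> *\<^sub>R real_cond_exp M F (indicator B) \<omega>)"
      using integrable_mult_indicator[OF A' real_cond_exp_int(1)[OF int]] .
    show "AE \<omega> in M. indicator A \<omega> *\<^sub>R p \<le> indicator A \<omega> *\<^sub>R real_cond_exp M F (indicator B) \<omega>"
      using ce by eventually_elim (auto simp: indicator_def)
  qed
  also have "\<dots> = (\<integral>\<omega>\<in>A. indicator B \<omega> \<partial>M)"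
    using real_cond_exp_intA[OF int A] by simp
  also have "\<dots> = prob (A \<inter> B)"
    using A' B by (simp add: set_lebesgue_integral_def indicator_inter_arith[symmetric])
  finally show ?thesis .
qed

text \<open>\<open>R k\<close> stands for iteration \<open>k\<close> being still carried out and
  \<open>B k\<close> for its gradient being accurate. The sum on the left is the expected number of
  iterations, and the expected number of inaccurate ones is at most \<open>\<delta>\<close> times
  it.\<close>

lemma (in prob_space) suminf_running_probability_le:
  assumes F: "\<And>k. subalgebra M (F k)" and R: "\<And>k. R k \<in> sets (F k)"
    and B: "\<And>k. B k \<in> events"
    and ce: "\<And>k. AE \<omega> in M. 1 - \<delta> \<le> real_cond_exp M (F k) (indicator (B k)) \<omega>"
    and R_decseq: "\<And>k. R (Suc k) \<subseteq> R k"
    and count: "\<And>n \<omega>. \<omega> \<in> space M \<Longrightarrow> (\<And>k. k < n \<Longrightarrow> \<omega> \<in> R k) \<Longrightarrow>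
      real n \<le> K + b * (\<Sum>k<n. of_bool (\<omega> \<notin> B k))"
    and "0 \<le> b" "\<delta> * b < 1"
  shows "(\<Sum>k. emeasure M (R k)) \<le> ennreal (K / (1 - \<delta> * b))"
proof (rule suminf_le_const)
  fix n
  have R': "R k \<in> events" for k
    using R[of k] F[of k] by (auto simp: subalgebra_def)
  \<comment> \<open>\<open>count\<close> speaks only of samples still running; once a sample has
    left \<open>R\<close>, both sums stop growing, so the bound persists for every
    \<open>n\<close>.\<close>
  have pathwise: "(\<Sum>k<n. indicator (R k) \<omega>) \<le> K + b * (\<Sum>k<n. indicator (R k - B k) \<omega>)"
    if \<omega>: "\<omega> \<in> space M" for \<omega> and n :: nat
  proof (induction n)
    case 0
    then show ?case using count[OF \<omega>, of 0] by simp
  next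
    case (Suc n)
    show ?case
    proof (cases "\<omega> \<in> R n")
      case True
      then have R: "\<omega> \<in> R k" if "k < Suc n" for k
        using lift_Suc_antimono_le[of R k n] R_decseq that by auto
      then have "(\<Sum>k<Suc n. indicator (R k) \<omega>) = real (Suc n)" by simp
      also have "\<dots> \<le> K + b * (\<Sum>k<Suc n. of_bool (\<omega> \<notin> B k))"
        using count[OF \<omega> R] by blast
      also have "(\<Sum>k<Suc n. of_bool (\<omega> \<notin> B k)) = (\<Sum>k<Suc n. indicator (R k - B k) \<omega> :: real)"
        using R by (intro sum.cong) (auto simp: indicator_def)
      finally show ?thesis .
    next
      case False
      then show ?thesis using Suc by simp
    qed
  qed
  have integrable: "integrable M (indicator A :: 'a \<Rightarrow> real)" if "A \<in> events" for A
    using that by (intro integrable_real_indicator) (auto simp: less_top[symmetric])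
  have miss: "prob (R k - B k) \<le> \<delta> * prob (R k)" for k
    using integral_cond_exp_lower_bound[OF F R B ce, of k] R'[of k] B[of k]
    by (simp add: finite_measure_Diff' algebra_simps)
  have "(\<Sum>k<n. prob (R k)) = expectation (\<lambda>\<omega>. \<Sum>k<n. indicator (R k) \<omega>)"
    using integrable R' by (simp add: Bochner_Integration.integral_sum)
  also have "\<dots> \<le> expectation (\<lambda>\<omega>. K + b * (\<Sum>k<n. indicator (R k - B k) \<omega>))"
    using integrable R' B pathwise by (intro integral_mono Bochner_Integration.integrable_add
      Bochner_Integration.integrable_sum integrable_mult_right) auto
  also have "\<dots> = K + b * (\<Sum>k<n. prob (R k - B k))"
    using integrable R' B by (simp add: Bochner_Integration.integral_sum prob_space)
  also have "\<dots> \<le> K + b * (\<Sum>k<n. \<delta> * prob (R k))"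
    using miss \<open>0 \<le> b\<close> by (intro add_left_mono mult_left_mono sum_mono) auto
  \<comment> \<open>The truncated sum is finite, so it may be moved to the left; finiteness of the
    full series is a conclusion.\<close>
  finally have "(1 - \<delta> * b) * (\<Sum>k<n. prob (R k)) \<le> K"
    by (simp add: sum_distrib_left[symmetric] algebra_simps)
  then have "(\<Sum>k<n. prob (R k)) \<le> K / (1 - \<delta> * b)"
    using \<open>\<delta> * b < 1\<close> by (simp add: pos_le_divide_eq mult.commute)
  then show "(\<Sum>k<n. emeasure M (R k)) \<le> ennreal (K / (1 - \<delta> * b))"
    by (simp add: emeasure_eq_measure sum_ennreal ennreal_leI)
qed simp

lemma hitting_index_greater_iff:
  "enat k < hitting_index \<phi> \<phi>star X \<epsilon> \<omega> \<longleftrightarrow> (\<forall>j\<le>k. \<epsilon> < \<phi> (X j \<omega>) - \<phi>star)"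
proof
  assume less: "enat k < hitting_index \<phi> \<phi>star X \<epsilon> \<omega>"
  show "\<forall>j\<le>k. \<epsilon> < \<phi> (X j \<omega>) - \<phi>star"
  proof (intro allI impI, rule ccontr)
    fix j
    assume j: "j \<le> k" "\<not> \<epsilon> < \<phi> (X j \<omega>) - \<phi>star"
    then have "hitting_index \<phi> \<phi>star X \<epsilon> \<omega> \<le> enat j"
      unfolding hitting_index_def by (intro INF_lower) auto
    with less j show False
      by (meson enat_ord_simps(1) leD order_trans)
  qed
next
  assume *: "\<forall>j\<le>k. \<epsilon> < \<phi> (X j \<omega>) - \<phi>star"
  have "enat (Suc k) \<le> hitting_index \<phi> \<phi>star X \<epsilon> \<omega>"
    unfolding hitting_index_def
  proof (rule INF_greatest)
    fix j
    assume "j \<in> {k. \<phi> (X k \<omega>) - \<phi>star \<le> \<epsilon>}"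
    with * have "\<not> j \<le> k" by fastforce
    then show "enat (Suc k) \<le> enat j" by simp
  qed
  then show "enat k < hitting_index \<phi> \<phi>star X \<epsilon> \<omega>"
    by (meson enat_ord_simps(2) lessI less_le_trans)
qed

text \<open>The tail-sum formula for the expectation of a variable with values in the extended
  naturals.\<close>

lemma nn_integral_hitting_index:
  assumes "\<And>k. {\<omega> \<in> space P. \<epsilon> < \<phi> (X k \<omega>) - \<phi>star} \<in> sets P"
  shows "(\<integral>\<^sup>+ \<omega>. ennreal_of_enat (hitting_index \<phi> \<phi>star X \<epsilon> \<omega>) \<partial>P)
    = (\<Sum>k. emeasure P {\<omega> \<in> space P. \<forall>j\<le>k. \<epsilon> < \<phi> (X j \<omega>) - \<phi>star})"
proof -
  have "{\<omega> \<in> space P. \<phi> (X k \<omega>) - \<phi>star \<le> \<epsilon>} \<in> sets P" for k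
  proof -
    have "{\<omega> \<in> space P. \<phi> (X k \<omega>) - \<phi>star \<le> \<epsilon>} = space P - {\<omega> \<in> space P. \<epsilon> < \<phi> (X k \<omega>) - \<phi>star}"
      by auto
    with assms[of k] show ?thesis by simp
  qed
  \<comment> \<open>The index set in \<open>hitting_index\<close> varies with the sample. Filling in
    \<open>\<top>\<close> gives an infimum over all \<open>k\<close>, whose measurability follows
    termwise.\<close>
  then have "(\<lambda>\<omega>. INF k. if \<phi> (X k \<omega>) - \<phi>star \<le> \<epsilon> then enat k else \<top>) \<in> measurable P (count_space UNIV)"
    by (intro measurable_INF measurable_If) auto
  moreover have "hitting_index \<phi> \<phi>star X \<epsilon> \<omega> = (INF k. if \<phi> (X k \<omega>) - \<phi>star \<le> \<epsilon> then enat k else \<top>)" for \<omega>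
    unfolding hitting_index_def
  proof (rule antisym; rule INF_greatest)
    fix k
    assume "k \<in> {k. \<phi> (X k \<omega>) - \<phi>star \<le> \<epsilon>}"
    then show "(INF k. if \<phi> (X k \<omega>) - \<phi>star \<le> \<epsilon> then enat k else \<top>) \<le> enat k"
      by (intro INF_lower2[of k]) auto
  qed (auto intro: INF_lower)
  ultimately have "hitting_index \<phi> \<phi>star X \<epsilon> \<in> measurable P (count_space UNIV)"
    by presburger
  then show ?thesis
    by (subst nn_integral_enat_function) (auto simp: hitting_index_greater_iff)
qed

section \<open>Measurability of the iterates with respect to the history\<close>

context
  fixes P :: "'w measure" and S :: "'s measure"
    and G :: "nat \<Rightarrow> 'w \<Rightarrow> real^'n" and \<Xi> \<Xi>' :: "nat \<Rightarrow> 'w \<Rightarrow> 's"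
  assumes G [measurable]: "\<And>k. G k \<in> measurable P borel"
    and \<Xi> [measurable]: "\<And>k. \<Xi> k \<in> measurable P S"
    and \<Xi>' [measurable]: "\<And>k. \<Xi>' k \<in> measurable P S"
begin

lemma history_map_measurable:
  "(\<lambda>\<omega>. \<lambda>i\<in>{..<k}. (G i \<omega>, \<Xi> i \<omega>, \<Xi>' i \<omega>))
    \<in> measurable P (\<Pi>\<^sub>M i\<in>{..<k}. borel \<Otimes>\<^sub>M S \<Otimes>\<^sub>M S)"
  by measurable

lemma history_component_measurable:
  assumes "i < k"
  shows "(\<lambda>\<omega>. (G i \<omega>, \<Xi> i \<omega>, \<Xi>' i \<omega>)) \<in> measurable (history P S G \<Xi> \<Xi>' k) (borel \<Otimes>\<^sub>M S \<Otimes>\<^sub>M S)"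
proof -
  have "(\<lambda>\<omega>. \<lambda>i\<in>{..<k}. (G i \<omega>, \<Xi> i \<omega>, \<Xi>' i \<omega>))
      \<in> measurable (history P S G \<Xi> \<Xi>' k) (\<Pi>\<^sub>M i\<in>{..<k}. borel \<Otimes>\<^sub>M S \<Otimes>\<^sub>M S)"
    unfolding history_def
    by (rule measurable_vimage_algebra1) (use history_map_measurable[of k] in \<open>blast dest: measurable_space\<close>)
  from measurable_compose[OF this measurable_component_singleton[of i]] \<open>i < k\<close>
  show ?thesis by simp
qed

lemma subalgebra_history: "subalgebra P (history P S G \<Xi> \<Xi>' k)"
proof -
  have "sets (history P S G \<Xi> \<Xi>' k) = {(\<lambda>\<omega>. \<lambda>i\<in>{..<k}. (G i \<omega>, \<Xi> i \<omega>, \<Xi>' i \<omega>)) -` A \<inter> space P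
      | A. A \<in> sets (\<Pi>\<^sub>M i\<in>{..<k}. borel \<Otimes>\<^sub>M S \<Otimes>\<^sub>M S)}"
    unfolding history_def
    by (rule sets_vimage_algebra2) (use history_map_measurable[of k] in \<open>blast dest: measurable_space\<close>)
  then show ?thesis
    using measurable_sets[OF history_map_measurable[of k]] by (auto simp: subalgebra_def history_def)
qed

end

text \<open>\<open>N\<close> is left arbitrary so that it can be the history before iteration
  \<open>k\<close>: the state at \<open>k\<close> involves only the data of iterations
  \<open>i < k\<close>.\<close>

lemma line_search_measurable:
  fixes f :: "real^'n \<Rightarrow> 's \<Rightarrow> real" and G :: "nat \<Rightarrow> 'w \<Rightarrow> real^'n"
  assumes f: "(\<lambda>(x, s). f x s) \<in> borel_measurable (borel \<Otimes>\<^sub>M S)"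
    and step: "\<And>i. i < k \<Longrightarrow> (\<lambda>\<omega>. (G i \<omega>, \<Xi> i \<omega>, \<Xi>' i \<omega>)) \<in> measurable N (borel \<Otimes>\<^sub>M S \<Otimes>\<^sub>M S)"
  shows "(\<lambda>\<omega>. line_search f c1 \<tau> epsf x0 \<alpha>0 (\<lambda>i. G i \<omega>) (\<lambda>i. \<Xi> i \<omega>) (\<lambda>i. \<Xi>' i \<omega>) k)
    \<in> measurable N (borel \<Otimes>\<^sub>M borel)"
  using step
proof (induction k)
  case 0
  then show ?case by simp
next
  case (Suc k)
  let ?z = "\<lambda>\<omega>. line_search f c1 \<tau> epsf x0 \<alpha>0 (\<lambda>i. G i \<omega>) (\<lambda>i. \<Xi> i \<omega>) (\<lambda>i. \<Xi>' i \<omega>) k"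
  have z [measurable]: "?z \<in> measurable N (borel \<Otimes>\<^sub>M borel)"
    using Suc by simp
  have t: "(\<lambda>\<omega>. (G k \<omega>, \<Xi> k \<omega>, \<Xi>' k \<omega>)) \<in> measurable N (borel \<Otimes>\<^sub>M S \<Otimes>\<^sub>M S)"
    using Suc.prems by simp
  have [measurable]: "G k \<in> measurable N borel"
    using measurable_compose[OF t measurable_fst] by simp
  have [measurable]: "\<Xi> k \<in> measurable N S"
    using measurable_compose[OF measurable_compose[OF t measurable_snd] measurable_fst] by simp
  have [measurable]: "\<Xi>' k \<in> measurable N S"
    using measurable_compose[OF measurable_compose[OF t measurable_snd] measurable_snd] by simp
  have f_meas: "(\<lambda>\<omega>. f (u \<omega>) (v \<omega>)) \<in> borel_measurable N"
    if [measurable]: "u \<in> measurable N borel" "v \<in> measurable N S" for u v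
    using measurable_compose[OF measurable_Pair[OF that] f] by simp
  have x [measurable]: "(\<lambda>\<omega>. fst (?z \<omega>)) \<in> borel_measurable N"
    and \<alpha> [measurable]: "(\<lambda>\<omega>. snd (?z \<omega>)) \<in> borel_measurable N"
    using measurable_compose[OF z measurable_fst] measurable_compose[OF z measurable_snd] by auto
  define x' where "x' \<omega> = fst (?z \<omega>) + snd (?z \<omega>) *\<^sub>R (- G k \<omega>)" for \<omega>
  have x' [measurable]: "x' \<in> borel_measurable N"
    unfolding x'_def by measurable
  have [measurable]: "(\<lambda>\<omega>. f (fst (?z \<omega>)) (\<Xi> k \<omega>)) \<in> borel_measurable N"
    "(\<lambda>\<omega>. f (x' \<omega>) (\<Xi>' k \<omega>)) \<in> borel_measurable N"
    by (intro f_meas; measurable)+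
  have "(\<lambda>\<omega>. if f (x' \<omega>) (\<Xi>' k \<omega>) \<le> f (fst (?z \<omega>)) (\<Xi> k \<omega>)
        + c1 * snd (?z \<omega>) * (- G k \<omega> \<bullet> G k \<omega>) + 2 * epsf
      then (x' \<omega>, inverse \<tau> * snd (?z \<omega>)) else (fst (?z \<omega>), \<tau> * snd (?z \<omega>)))
    \<in> measurable N (borel \<Otimes>\<^sub>M borel)"
    by measurable
  moreover have "line_search f c1 \<tau> epsf x0 \<alpha>0 (\<lambda>i. G i \<omega>) (\<lambda>i. \<Xi> i \<omega>) (\<lambda>i. \<Xi>' i \<omega>) (Suc k)
    = (if f (x' \<omega>) (\<Xi>' k \<omega>) \<le> f (fst (?z \<omega>)) (\<Xi> k \<omega>)
        + c1 * snd (?z \<omega>) * (- G k \<omega> \<bullet> G k \<omega>) + 2 * epsf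
      then (x' \<omega>, inverse \<tau> * snd (?z \<omega>)) else (fst (?z \<omega>), \<tau> * snd (?z \<omega>)))" for \<omega>
    by (cases "?z \<omega>") (simp add: sufficient_decrease_def x'_def)
  ultimately show ?case by presburger
qed

section \<open>Comparison of constants and the expected hitting time\<close>

text \<open>Compares the factor produced by the counting argument with the one claimed. In terms of
  \<open>q = 1 - 2 * \<delta>\<close>, the hypothesis on \<open>\<delta>\<close> reads
  \<open>sqrt \<gamma> < q\<close>, and \<open>2 * (1 - \<delta>)\<close> becomes
  \<open>1 + q\<close>.\<close>

lemma step_factor_bound:
  fixes \<delta> \<gamma> :: real
  assumes "0 \<le> \<delta>" "0 < \<gamma>" "\<gamma> < 1" "\<delta> < 1 / 2 - sqrt \<gamma> / 2"
  shows "\<delta> * (2 + 2 * \<gamma>) < 1"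
    and "2 / (1 - \<delta> * (2 + 2 * \<gamma>)) \<le> 2 * (1 - \<delta>) / ((1 - 2 * \<delta>)\<^sup>2 - \<gamma>) * (1 - \<gamma>)"
    and "0 < (1 - 2 * \<delta>)\<^sup>2 - \<gamma>"
    and "\<delta> < 1"
proof -
  define q where "q = 1 - 2 * \<delta>"
  have q: "sqrt \<gamma> < q" "q \<le> 1" using assms by (auto simp: q_def)
  have "0 < q" using q assms(2) by (meson less_trans real_sqrt_gt_zero)
  then show "\<delta> < 1" by (simp add: q_def)
  have "\<gamma> < q\<^sup>2"
    using q(1) assms(2) power_strict_mono[of "sqrt \<gamma>" q 2] by simp
  then show gap: "0 < (1 - 2 * \<delta>)\<^sup>2 - \<gamma>" by (simp add: q_def)
  have "q\<^sup>2 \<le> q" using q \<open>0 < q\<close> by (simp add: power2_eq_square mult_left_le)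
  have d: "1 - \<delta> * (2 + 2 * \<gamma>) = q - (1 - q) * \<gamma>" by (simp add: q_def algebra_simps)
  have "(1 - q) * \<gamma> \<le> \<gamma>" using \<open>0 < q\<close> assms(2) by (simp add: mult_left_le_one_le)
  then have d_pos: "0 < q - (1 - q) * \<gamma>"
    using \<open>\<gamma> < q\<^sup>2\<close> \<open>q\<^sup>2 \<le> q\<close> by linarith
  then show "\<delta> * (2 + 2 * \<gamma>) < 1" using d by linarith
  \<comment> \<open>The cross-multiplied difference factors with \<open>1 - q\<close>, which shows
    its sign; it vanishes at \<open>q = 1\<close>, that is, for \<open>\<delta> = 0\<close>.\<close>
  have "(1 + q) * (1 - \<gamma>) * (q - (1 - q) * \<gamma>) - 2 * (q\<^sup>2 - \<gamma>)
      = (1 - q) * (q + \<gamma> + (1 + q) * \<gamma>\<^sup>2)"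
    by (simp add: algebra_simps power2_eq_square)
  moreover have "0 \<le> (1 - q) * (q + \<gamma> + (1 + q) * \<gamma>\<^sup>2)"
    using q \<open>0 < q\<close> assms(2) by (intro mult_nonneg_nonneg add_nonneg_nonneg) auto
  ultimately have "2 * (q\<^sup>2 - \<gamma>) \<le> (1 + q) * (1 - \<gamma>) * (q - (1 - q) * \<gamma>)"
    by linarith
  then have "2 \<le> (1 + q) * (1 - \<gamma>) * (q - (1 - q) * \<gamma>) / (q\<^sup>2 - \<gamma>)"
    using \<open>\<gamma> < q\<^sup>2\<close> by (intro mult_imp_le_div_pos) auto
  then have "2 / (q - (1 - q) * \<gamma>) \<le> (1 + q) * (1 - \<gamma>) / (q\<^sup>2 - \<gamma>)"
    using d_pos by (intro mult_imp_div_pos_le) auto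
  also have "\<dots> = 2 * (1 - \<delta>) / ((1 - 2 * \<delta>)\<^sup>2 - \<gamma>) * (1 - \<gamma>)"
    by (simp add: q_def)
  finally show "2 / (1 - \<delta> * (2 + 2 * \<gamma>)) \<le> 2 * (1 - \<delta>) / ((1 - 2 * \<delta>)\<^sup>2 - \<gamma>) * (1 - \<gamma>)"
    unfolding d .
qed

theorem theorem4p10:
  fixes P :: "'w measure" and S :: "'s measure"
    and \<phi> :: "real^'n \<Rightarrow> real" and grad :: "real^'n \<Rightarrow> real^'n"
    and f :: "real^'n \<Rightarrow> 's \<Rightarrow> real"
    and G :: "nat \<Rightarrow> 'w \<Rightarrow> real^'n" and \<Xi> \<Xi>' :: "nat \<Rightarrow> 'w \<Rightarrow> 's"
    and x0 xstar :: "real^'n" and U :: "(real^'n) set"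
    and L D \<tau> c1 epsf \<alpha>0 \<theta> \<delta> \<gamma> \<epsilon> :: real and c :: nat
  defines "X \<equiv> iterate f c1 \<tau> epsf x0 \<alpha>0 G \<Xi> \<Xi>'"
    and "\<alpha>bar \<equiv> step_threshold L \<theta> c1"
    and "M \<equiv> rate_const L D \<theta> c1"
  assumes "prob_space P"
    and "\<And>k. G k \<in> measurable P borel"
    and "\<And>k. \<Xi> k \<in> measurable P S" and "\<And>k. \<Xi>' k \<in> measurable P S"
    and "(\<lambda>(x, s). f x s) \<in> borel_measurable (borel \<Otimes>\<^sub>M S)"
    and "0 < \<alpha>0" and "0 < \<tau>" and "\<tau> \<le> 1" and "0 < c1" and "c1 < 1" and "0 \<le> epsf"
    and "convex_on UNIV \<phi>"
    and "\<And>x. GDERIV \<phi> x :> grad x" and "continuous_on UNIV grad"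
    and "0 < L" and "L-lipschitz_on UNIV grad"
    and "\<And>x s. s \<in> space S \<Longrightarrow> \<bar>f x s - \<phi> x\<bar> \<le> epsf"
    and "\<And>x. \<phi> xstar \<le> \<phi> x"
    and "0 < D" and "\<And>x. x \<in> U \<Longrightarrow> norm (x - xstar) \<le> D"
    and "\<And>k \<omega>. \<omega> \<in> space P \<Longrightarrow> X k \<omega> \<in> U"
    and "0 \<le> \<theta>" and "\<theta> < (1 - c1) / (2 - c1)"
    and "sufficiently_accurate P (history P S G \<Xi> \<Xi>') grad X G \<theta> \<delta>"
    and "0 < \<gamma>" and "\<gamma> < 1" and "\<delta> < 1 / 2 - sqrt \<gamma> / 2"
    and "0 < \<epsilon>"
    and "\<epsilon>\<^sup>2 > max (8 * epsf * L * D\<^sup>2 /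
                    (\<gamma> * c1 * (1 - \<theta>) * (1 - 2 * \<theta> - c1 * (1 - \<theta>))))
                 (16 * epsf\<^sup>2)"
    and "0 < c" and "\<alpha>bar = \<tau> ^ c * \<alpha>0"
    and "\<epsilon> \<le> \<phi> x0 - \<phi> xstar"
    and "\<tau> = 1 \<Longrightarrow> 1 \<le> M * (1 / \<epsilon> - 1 / (\<phi> x0 - \<phi> xstar))"
  shows "(\<integral>\<^sup>+ \<omega>. ennreal_of_enat (hitting_index \<phi> (\<phi> xstar) X \<epsilon> \<omega>) \<partial>P)
         \<le> ennreal (2 * (1 - \<delta>) / ((1 - 2 * \<delta>)\<^sup>2 - \<gamma>) *
             (M * (1 / \<epsilon> - 1 / (\<phi> x0 - \<phi> xstar)) + (1 - \<gamma>) * log \<tau> (\<alpha>bar / \<alpha>0)))"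
proof -
  interpret prob_space P by fact
  interpret noisy_convex_line_search S \<phi> grad f xstar L D \<tau> c1 epsf \<alpha>0 \<theta> \<gamma> \<epsilon> c
    using assms(2,9-16,18-20,22,25,26,28,29,31,32,34) by unfold_locales auto
  note [measurable] = assms(5-7)
  define N where "N = history P S G \<Xi> \<Xi>'"
  define R where "R k = {\<omega> \<in> space P. \<forall>j\<le>k. \<epsilon> < \<phi> (X j \<omega>) - \<phi> xstar}" for k
  define B where "B k = {\<omega> \<in> space P. norm (G k \<omega> - grad (X k \<omega>)) \<le> \<theta> * norm (grad (X k \<omega>))}" for k
  define K where "K = potential x0 \<alpha>0 + 1"
  have N: "subalgebra P (N k)" for k
    unfolding N_def by (rule subalgebra_history) (use assms(5-7) in auto)
  have X_N: "X j \<in> borel_measurable (N k)" if "j \<le> k" for j k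
    unfolding assms(1) iterate_def N_def
    by (rule measurable_compose[OF line_search_measurable[OF assms(8)] measurable_fst],
        rule history_component_measurable[OF assms(5-7)])
       (use that in auto)
  have X_P [measurable]: "X k \<in> borel_measurable P" for k
    using measurable_from_subalg[OF N X_N[of k k]] by simp
  have "continuous_on UNIV \<phi>"
    using assms(16) by (auto simp: gderiv_def intro!: continuous_at_imp_continuous_on has_derivative_continuous)
  then have \<phi>: "\<phi> \<in> borel_measurable borel"
    by (rule borel_measurable_continuous_onI)
  have [measurable]: "grad \<in> borel_measurable borel"
    using assms(17) by (rule borel_measurable_continuous_onI)
  have gap_sets: "{\<omega> \<in> space P. \<epsilon> < \<phi> (X j \<omega>) - \<phi> xstar} \<in> sets (N k)" if "j \<le> k" for j k
  proof -
    have [measurable]: "(\<lambda>\<omega>. \<phi> (X j \<omega>)) \<in> borel_measurable (N k)"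
      using measurable_compose[OF X_N[OF that] \<phi>] .
    have "{\<omega> \<in> space (N k). \<epsilon> < \<phi> (X j \<omega>) - \<phi> xstar} \<in> sets (N k)"
      by measurable
    moreover have "space (N k) = space P" using N[of k] by (simp add: subalgebra_def)
    ultimately show ?thesis by (simp only:)
  qed
  \<comment> \<open>Whether iteration \<open>k\<close> is still carried out depends on the iterates
    up to index \<open>k\<close>, all of them known from the history before iteration
    \<open>k\<close>.\<close>
  have R: "R k \<in> sets (N k)" for k
  proof -
    have "R k = (\<Inter>j\<in>{..k}. {\<omega> \<in> space P. \<epsilon> < \<phi> (X j \<omega>) - \<phi> xstar})"
      by (auto simp: R_def)
    then show ?thesis using gap_sets by (auto intro!: sets.finite_INT)
  qed
  have B: "B k \<in> events" for k
    unfolding B_def by measurable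
  have accurate: "AE \<omega> in P. 1 - \<delta> \<le> real_cond_exp P (N k) (indicator (B k)) \<omega>" for k
    using assms(27) by (simp add: sufficiently_accurate_def N_def B_def)
  \<comment> \<open>The sign of \<open>\<delta>\<close> comes from the accuracy condition itself:
    integrated over the whole space, it bounds \<open>1 - \<delta>\<close> by a probability.\<close>
  have "1 - \<delta> \<le> prob (space P \<inter> B 0)"
    using integral_cond_exp_lower_bound[OF N[of 0] _ B accurate, of "space P"] N[of 0] sets.top[of "N 0"]
    by (simp add: subalgebra_def prob_space)
  then have "0 \<le> \<delta>"
    using prob_le_1[of "space P \<inter> B 0"] by linarith
  note factor = step_factor_bound[OF this assms(28-30)]
  have "(\<integral>\<^sup>+ \<omega>. ennreal_of_enat (hitting_index \<phi> (\<phi> xstar) X \<epsilon> \<omega>) \<partial>P) = (\<Sum>k. emeasure P (R k))"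
    unfolding R_def
  proof (rule nn_integral_hitting_index)
    show "{\<omega> \<in> space P. \<epsilon> < \<phi> (X k \<omega>) - \<phi> xstar} \<in> events" for k
      using gap_sets[of k k] N[of k] unfolding subalgebra_def by blast
  qed
  also have "\<dots> \<le> ennreal (K / (1 - \<delta> * (2 + 2 * \<gamma>)))"
  proof (rule suminf_running_probability_le[OF N R B accurate])
    fix n \<omega>
    assume \<omega>: "\<omega> \<in> space P" and run: "\<And>k. k < n \<Longrightarrow> \<omega> \<in> R k"
    have "real n \<le> potential x0 \<alpha>0 + 1 + (2 + 2 * \<gamma>) *
      (\<Sum>k<n. of_bool (\<not> norm (G k \<omega> - grad (X k \<omega>)) \<le> \<theta> * norm (grad (X k \<omega>))))"
      unfolding assms(1) iterate_def
    proof (rule iteration_count)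
      fix k
      show "\<Xi> k \<omega> \<in> space S" "\<Xi>' k \<omega> \<in> space S"
        using measurable_space[OF assms(6) \<omega>] measurable_space[OF assms(7) \<omega>] by auto
      show "norm (fst (line_search f c1 \<tau> epsf x0 \<alpha>0 (\<lambda>i. G i \<omega>) (\<lambda>i. \<Xi> i \<omega>) (\<lambda>i. \<Xi>' i \<omega>) k) - xstar) \<le> D"
        using assms(23)[OF assms(24)[OF \<omega>, of k]] by (simp add: assms(1) iterate_def)
      show "\<epsilon> < \<phi> (fst (line_search f c1 \<tau> epsf x0 \<alpha>0 (\<lambda>i. G i \<omega>) (\<lambda>i. \<Xi> i \<omega>) (\<lambda>i. \<Xi>' i \<omega>) k)) - \<phi> xstar"
        if "k < n"
        using run[OF that] by (simp add: R_def assms(1) iterate_def)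
    qed (rule assms(35))
    then show "real n \<le> K + (2 + 2 * \<gamma>) * (\<Sum>k<n. of_bool (\<omega> \<notin> B k))"
      using \<omega> by (simp add: K_def B_def)
  qed (use factor \<gamma>_pos in \<open>auto simp: R_def\<close>)
  also have "\<dots> \<le> ennreal (2 * (1 - \<delta>) / ((1 - 2 * \<delta>)\<^sup>2 - \<gamma>) *
             (M * (1 / \<epsilon> - 1 / (\<phi> x0 - \<phi> xstar)) + (1 - \<gamma>) * log \<tau> (\<alpha>bar / \<alpha>0)))"
  proof (rule ennreal_leI)
    define C where "C = 2 * (1 - \<delta>) / ((1 - 2 * \<delta>)\<^sup>2 - \<gamma>)"
    define Z where "Z = M * (1 / \<epsilon> - 1 / (\<phi> x0 - \<phi> xstar))"
    define l where "l = log \<tau> (\<alpha>bar / \<alpha>0)"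
    have l: "l = real c * of_bool (\<tau> < 1)"
      using level_initial by (simp add: l_def level_def assms(2))
    \<comment> \<open>The initial level is nonnegative, so \<open>level_cost\<close> is the identity
      there.\<close>
    have K: "K = Z + l + 1"
      using level_initial by (simp add: K_def Z_def l potential_def level_cost_def assms(3))
    have "1 / (\<phi> x0 - \<phi> xstar) \<le> 1 / \<epsilon>"
      using assms(31,35) by (intro divide_left_mono mult_pos_pos) auto
    then have "0 \<le> Z" using M_pos by (simp add: Z_def assms(3))
    \<comment> \<open>This lets the additive 1 in \<open>K\<close> be absorbed by doubling. For
      \<open>\<tau> < 1\<close> the initial level \<open>c\<close> is at least 1; for
      \<open>\<tau> = 1\<close> the logarithm is 0 and the hypothesis on \<open>M\<close> gives the
      bound.\<close>
    have "1 \<le> Z + l"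
    proof (cases "\<tau> = 1")
      case True
      then show ?thesis using assms(36) l by (simp add: Z_def)
    next
      case False
      then show ?thesis using \<open>0 \<le> Z\<close> assms(33) \<tau>_le1 l by simp
    qed
    have "0 \<le> C"
      unfolding C_def using factor(4) by (intro divide_nonneg_pos factor(3)) simp
    have "K / (1 - \<delta> * (2 + 2 * \<gamma>)) \<le> 2 * (Z + l) / (1 - \<delta> * (2 + 2 * \<gamma>))"
      using \<open>1 \<le> Z + l\<close> factor(1) by (intro divide_right_mono) (auto simp: K)
    also have "\<dots> = 2 / (1 - \<delta> * (2 + 2 * \<gamma>)) * (Z + l)" by simp
    also have "\<dots> \<le> C * (1 - \<gamma>) * (Z + l)"
      using factor(2) \<open>1 \<le> Z + l\<close> by (intro mult_right_mono) (auto simp: C_def)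
    \<comment> \<open>The factor \<open>1 - \<gamma>\<close> is available on both terms; it is kept
      on \<open>l\<close> and given up on \<open>Z\<close> to match the claimed form.\<close>
    also have "\<dots> = C * ((1 - \<gamma>) * Z + (1 - \<gamma>) * l)" by (simp add: algebra_simps)
    also have "\<dots> \<le> C * (Z + (1 - \<gamma>) * l)"
      using \<open>0 \<le> C\<close> \<open>0 \<le> Z\<close> \<gamma>_pos \<gamma>_less1
      by (intro mult_left_mono add_right_mono mult_left_le_one_le) auto
    finally show "K / (1 - \<delta> * (2 + 2 * \<gamma>)) \<le> C * (Z + (1 - \<gamma>) * l)" .
  qed
  finally show ?thesis .
qed

end
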